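(* Let $d,p\in\mathbb{R}$ with $d\neq 0$, let $\phi:\mathbb{R}_+\to\mathbb{R}_+$ be a measurable function such that $$\int_0^\infty t^{n+p-1}\phi(t^d)\,dt<\infty,$$ and let $g,h$ be nonnegative positively homogeneous functions on $\mathbb{R}^n$ of degree $d$ and $p$ respectively. The functional $\int_{\mathbb{R}^n}\phi(g(\mathbf{x}))h(\mathbf{x})\,d\mathbf{x}$ is finite if and only if $\int_{\mathbb{R}^n}h\exp(-g)\,d\mathbf{x}<+\infty$, in which case $$\int_{\mathbb{R}^n}\phi(g(\mathbf{x}))\,h(\mathbf{x})\,d\mathbf{x}\;=\;\frac{d\int_0^\infty t^{n+p-1}\phi(t^d)\,dt}{\Gamma((n+p)/d)}\cdot\int_{\mathbb{R}^n}h\exp(-g)\,d\mathbf{x},$$ where the factor in front of the last integral is a constant depending only on $n,p,d,\phi$.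
   Context: A real-valued continuous function $f:\mathbb{R}^n\to\mathbb{R}$ is positively homogeneous of degree $k\in\mathbb{R}$ if $f(\lambda\mathbf{x})=\lambda^k f(\mathbf{x})$ for all $\lambda>0$ and all $\mathbf{x}\in\mathbb{R}^n$. $\Gamma$ is the standard Gamma function. $\mathbb{R}_+=[0,\infty)$.
   Formalization: "∫φ(g)h finite ⟹ ∫h exp(-g) finite" is false in general (φ=0, g=0, h=1); it is proved if ∫t^(n+p-1)φ(t^d)dt>0 and either φ(0)>0 or h=0 a.e. on {g=0}. The other direction and the formula are unrestricted. *)

theory Defs
  imports "HOL-Analysis.Analysis"
begin

text \<open>
  Continuity is required on the whole space, the origin included, as part of the notion.
  Consequently a function of negative degree vanishes identically.
\<close>

definition positively_homogeneous :: "real \<Rightarrow> (real ^ 'n \<Rightarrow> real) \<Rightarrow> bool" where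
  "positively_homogeneous k f \<longleftrightarrow>
     continuous_on UNIV f \<and> (\<forall>c>0. \<forall>x. f (c *\<^sub>R x) = c powr k * f x)"

end

theory Submission imports Defs begin

text \<open>
  With \<open>q = n + p\<close> and \<open>r = g\<^sup>1\<^sup>/\<^sup>d\<close>, homogeneous of degree \<open>1\<close>, the image of the measure \<open>h dx\<close> on
  \<open>{r > 0}\<close> under \<open>r\<close> is \<open>C t\<^sup>q\<^sup>-\<^sup>1 dt\<close> for some \<open>C \<in> [0, \<infinity>]\<close>. This is seen by integrating
  \<open>1[r(x) \<in> [1, 2]] h(x) t\<^sup>q\<^sup>-\<^sup>1 \<Psi>(t r(x))\<close> over \<open>(x, t)\<close> in both orders, rescaling \<open>t\<close> in one and \<open>x\<close> in
  the other; nothing has to be finite. Taking \<open>\<Psi>(t) = \<phi>(t\<^sup>d)\<close> and \<open>\<Psi>(t) = exp(-t\<^sup>d)\<close> gives both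
  integrals over \<open>{g > 0}\<close> with the same \<open>C\<close>. On the cone \<open>{g = 0}\<close>, scaling forces the integral
  of \<open>h\<close> to be \<open>0\<close> or \<open>\<infinity>\<close>.
\<close>

section \<open>Polar integration for a function homogeneous of degree one\<close>

lemma nn_integral_lborel_scaleR:
  fixes f :: "'a::euclidean_space \<Rightarrow> ennreal"
  assumes [measurable]: "f \<in> borel_measurable borel" and "c > 0"
  shows "(\<integral>\<^sup>+x. f x \<partial>lborel) = ennreal (c ^ DIM('a)) * (\<integral>\<^sup>+x. f (c *\<^sub>R x) \<partial>lborel)"
  using assms
  by (subst lborel_affine[of c 0])
     (auto simp: nn_integral_density nn_integral_distr nn_integral_cmult)

text \<open>Values in \<open>ennreal\<close> let \<open>C\<close> be infinite, as for
  \<open>r x = |x_1|\<close> and \<open>h = 1\<close> in the plane, where the set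
  \<open>1 <= r <= 2\<close> has infinite area.\<close>

lemma nn_integral_polar:
  fixes r h :: "'a::euclidean_space \<Rightarrow> real" and p :: real
  assumes [measurable]: "r \<in> borel_measurable borel" "h \<in> borel_measurable borel"
    and r: "\<And>c x. c > 0 \<Longrightarrow> r (c *\<^sub>R x) = c * r x"
    and h: "\<And>c x. c > 0 \<Longrightarrow> h (c *\<^sub>R x) = c powr p * h x"
  obtains C :: ennreal where
    "\<And>\<Psi>. \<Psi> \<in> borel_measurable borel \<Longrightarrow>
      (\<integral>\<^sup>+x. indicator {0<..} (r x) * \<Psi> (r x) * ennreal (h x) \<partial>lborel) =
      C * (\<integral>\<^sup>+t. indicator {0<..} t * ennreal (t powr (DIM('a) + p - 1)) * \<Psi> t \<partial>lborel)"
proof -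
  define q where "q = DIM('a) + p"
  \<comment> \<open>\<open>L\<close> is log 2, the \<open>dt/t\<close> length of
    \<open>[1/2, 1]\<close>. Only \<open>0 < L < \<infinity>\<close> is used, which makes division
    by \<open>L\<close> legitimate in \<open>ennreal\<close>; \<open>M\<close> may be
    infinite.\<close>
  define L where "L = (\<integral>\<^sup>+t. indicator {1/2..1} t * ennreal (1 / t) \<partial>lborel)"
  define M where "M = (\<integral>\<^sup>+x. indicator {1..2} (r x) * ennreal (r x powr - q) * ennreal (h x) \<partial>lborel)"
  have "L \<le> (\<integral>\<^sup>+t. 2 * indicator {1/2..1::real} t \<partial>lborel)"
    unfolding L_def
    by (intro nn_integral_mono) (auto simp: indicator_def field_simps simp flip: ennreal_numeral intro!: ennreal_leI)
  also have "\<dots> = 2 * ennreal (1/2)"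
    by (subst nn_integral_cmult) auto
  finally have Lfin: "L \<noteq> \<infinity>"
    by (metis ennreal_mult_eq_top_iff ennreal_neq_top ennreal_numeral infinity_ennreal_def neq_top_trans)
  have "(\<integral>\<^sup>+t. 1 * indicator {1/2..1::real} t \<partial>lborel) \<le> L"
    unfolding L_def
    by (intro nn_integral_mono) (auto simp: indicator_def)
  hence Lpos: "L \<noteq> 0" by auto
  show ?thesis
  proof (rule that[of "M / L"])
    fix \<Psi> :: "real \<Rightarrow> ennreal" assume [measurable]: "\<Psi> \<in> borel_measurable borel"
    define F where "F = (\<integral>\<^sup>+x. indicator {0<..} (r x) * \<Psi> (r x) * ennreal (h x) \<partial>lborel)"
    define K where "K = (\<integral>\<^sup>+t. indicator {0<..} t * ennreal (t powr (q - 1)) * \<Psi> t \<partial>lborel)"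
    define D where "D = (\<integral>\<^sup>+x. (\<integral>\<^sup>+t. indicator {1..2} (r x) * ennreal (h x) *
      (indicator {0<..} t * ennreal (t powr (q - 1)) * \<Psi> (r x * t)) \<partial>lborel) \<partial>lborel)"
    \<comment> \<open>The measure \<open>t powr (q - 1) dt\<close> scales with degree
      \<open>q\<close>, so replacing \<open>t\<close> by \<open>s * t\<close> in \<open>K\<close>
      produces \<open>s powr q\<close>. As \<open>K\<close> may be infinite, this factor is moved
      across by multiplying with its inverse.\<close>
    have inner: "(\<integral>\<^sup>+t. indicator {0<..} t * ennreal (t powr (q - 1)) * \<Psi> (s * t) \<partial>lborel) =
        ennreal (s powr - q) * K" if "s > 0" for s
    proof -
      have "K = ennreal s * (\<integral>\<^sup>+t. indicator {0<..} (s * t) * ennreal ((s * t) powr (q - 1)) * \<Psi> (s * t) \<partial>lborel)"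
        unfolding K_def using nn_integral_lborel_scaleR[OF _ that, of "\<lambda>t. indicator {0<..} t * ennreal (t powr (q - 1)) * \<Psi> t"] by simp
      also have "(\<integral>\<^sup>+t. indicator {0<..} (s * t) * ennreal ((s * t) powr (q - 1)) * \<Psi> (s * t) \<partial>lborel)
         = (\<integral>\<^sup>+t. ennreal (s powr (q - 1)) * (indicator {0<..} t * ennreal (t powr (q - 1)) * \<Psi> (s * t)) \<partial>lborel)"
        using that by (intro nn_integral_cong)
          (auto simp: indicator_def powr_mult ennreal_mult zero_less_mult_iff mult_ac)
      also have "\<dots> = ennreal (s powr (q - 1)) * (\<integral>\<^sup>+t. indicator {0<..} t * ennreal (t powr (q - 1)) * \<Psi> (s * t) \<partial>lborel)"
        by (rule nn_integral_cmult) measurable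
      finally have "ennreal (s powr - q) * K = ennreal (s powr - q) * (ennreal s * ennreal (s powr (q - 1))) *
          (\<integral>\<^sup>+t. indicator {0<..} t * ennreal (t powr (q - 1)) * \<Psi> (s * t) \<partial>lborel)"
        by (simp add: mult_ac)
      moreover have "ennreal (s powr - q) * (ennreal s * ennreal (s powr (q - 1))) = 1"
        using that by (simp add: powr_diff powr_minus field_simps flip: ennreal_mult)
      ultimately show ?thesis by simp
    qed
    have "D = (\<integral>\<^sup>+x. K * (indicator {1..2} (r x) * ennreal (r x powr - q) * ennreal (h x)) \<partial>lborel)"
      unfolding D_def
    proof (rule nn_integral_cong)
      fix x
      show "(\<integral>\<^sup>+t. indicator {1..2} (r x) * ennreal (h x) *
          (indicator {0<..} t * ennreal (t powr (q - 1)) * \<Psi> (r x * t)) \<partial>lborel) =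
          K * (indicator {1..2} (r x) * ennreal (r x powr - q) * ennreal (h x))"
        using inner[of "r x"]
        by (subst nn_integral_cmult) (auto simp: indicator_def mult_ac)
    qed
    also have "\<dots> = K * M"
      unfolding M_def by (rule nn_integral_cmult) measurable
    finally have D1: "D = K * M" .

    have "D = (\<integral>\<^sup>+t. (\<integral>\<^sup>+x. indicator {1..2} (r x) * ennreal (h x) *
      (indicator {0<..} t * ennreal (t powr (q - 1)) * \<Psi> (r x * t)) \<partial>lborel) \<partial>lborel)"
      unfolding D_def by (rule lborel_pair.Fubini') measurable
    \<comment> \<open>The new integrand is built so that substituting \<open>t *\<^sub>R x\<close>
      for \<open>x\<close> gives back the old one: Lebesgue measure yields
      \<open>t ^ DIM('a)\<close>, \<open>h\<close> yields \<open>t powr p\<close>, and with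
      \<open>1 / t\<close> these make \<open>t powr (q - 1)\<close>.\<close>
    also have "\<dots> = (\<integral>\<^sup>+t. (\<integral>\<^sup>+x. indicator {0<..} (r x) * \<Psi> (r x) * ennreal (h x) *
        (indicator {0<..} t * ennreal (1 / t) * indicator {1..2} (r x / t)) \<partial>lborel) \<partial>lborel)"
    proof (rule nn_integral_cong)
      fix t :: real
      show "(\<integral>\<^sup>+x. indicator {1..2} (r x) * ennreal (h x) *
          (indicator {0<..} t * ennreal (t powr (q - 1)) * \<Psi> (r x * t)) \<partial>lborel) =
        (\<integral>\<^sup>+x. indicator {0<..} (r x) * \<Psi> (r x) * ennreal (h x) *
          (indicator {0<..} t * ennreal (1 / t) * indicator {1..2} (r x / t)) \<partial>lborel)" (is "?l = ?r")
      proof (cases "t > 0")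
        case True
        have "?r = ennreal (t ^ DIM('a)) * (\<integral>\<^sup>+x. indicator {0<..} (r (t *\<^sub>R x)) * \<Psi> (r (t *\<^sub>R x)) * ennreal (h (t *\<^sub>R x)) *
          (indicator {0<..} t * ennreal (1 / t) * indicator {1..2} (r (t *\<^sub>R x) / t)) \<partial>lborel)"
          by (rule nn_integral_lborel_scaleR[OF _ True]) measurable
        also have "\<dots> = (\<integral>\<^sup>+x. ennreal (t ^ DIM('a)) * (indicator {0<..} (r (t *\<^sub>R x)) * \<Psi> (r (t *\<^sub>R x)) * ennreal (h (t *\<^sub>R x)) *
          (indicator {0<..} t * ennreal (1 / t) * indicator {1..2} (r (t *\<^sub>R x) / t))) \<partial>lborel)"
          by (rule nn_integral_cmult[symmetric]) measurable
        also have "\<dots> = ?l"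
        proof (rule nn_integral_cong)
          fix x
          have "ennreal (t powr (q - 1)) = ennreal (t ^ DIM('a)) * (ennreal (t powr p) * ennreal (1 / t))"
            using True by (simp add: q_def powr_diff powr_add powr_realpow field_simps flip: ennreal_mult)
          moreover have "ennreal (h (t *\<^sub>R x)) = ennreal (t powr p) * ennreal (h x)"
            using True by (simp add: h ennreal_mult')
          ultimately show "ennreal (t ^ DIM('a)) * (indicator {0<..} (r (t *\<^sub>R x)) * \<Psi> (r (t *\<^sub>R x)) * ennreal (h (t *\<^sub>R x)) *
              (indicator {0<..} t * ennreal (1 / t) * indicator {1..2} (r (t *\<^sub>R x) / t))) =
            indicator {1..2} (r x) * ennreal (h x) *
              (indicator {0<..} t * ennreal (t powr (q - 1)) * \<Psi> (r x * t))"
            using True by (auto simp: indicator_def r mult_ac)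
        qed
        finally show ?thesis ..
      qed auto
    qed
    also have "\<dots> = (\<integral>\<^sup>+x. (\<integral>\<^sup>+t. indicator {0<..} (r x) * \<Psi> (r x) * ennreal (h x) *
        (indicator {0<..} t * ennreal (1 / t) * indicator {1..2} (r x / t)) \<partial>lborel) \<partial>lborel)"
      by (rule lborel_pair.Fubini') measurable
    also have "\<dots> = (\<integral>\<^sup>+x. L * (indicator {0<..} (r x) * \<Psi> (r x) * ennreal (h x)) \<partial>lborel)"
    proof (rule nn_integral_cong)
      fix x
      \<comment> \<open>\<open>dt/t\<close> is invariant under scaling, so \<open>s\<close> drops
        out: after \<open>t\<close> becomes \<open>s * t\<close>, the condition on
        \<open>s / t\<close> says that \<open>1 / t\<close> lies in \<open>[1, 2]\<close>, which is
        the window \<open>[1/2, 1]\<close> of \<open>L\<close>.\<close>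
      have "(\<integral>\<^sup>+t. indicator {0<..} t * ennreal (1 / t) * indicator {1..2} (s / t) \<partial>lborel) = L"
        if "s > 0" for s :: real
      proof -
        have "(\<integral>\<^sup>+t. indicator {0<..} t * ennreal (1 / t) * indicator {1..2} (s / t) \<partial>lborel) =
          ennreal s * (\<integral>\<^sup>+t. indicator {0<..} (s * t) * ennreal (1 / (s * t)) * indicator {1..2} (s / (s * t)) \<partial>lborel)"
          using nn_integral_lborel_scaleR[OF _ that, of "\<lambda>t. indicator {0<..} t * ennreal (1 / t) * indicator {1..2} (s / t)"] by simp
        also have "\<dots> = (\<integral>\<^sup>+t. ennreal s * (indicator {0<..} (s * t) * ennreal (1 / (s * t)) * indicator {1..2} (s / (s * t))) \<partial>lborel)"
          by (rule nn_integral_cmult[symmetric]) measurable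
        also have "\<dots> = L"
          unfolding L_def
        proof (rule nn_integral_cong)
          fix t
          have "t > 0 \<Longrightarrow> ennreal s * ennreal (1 / (s * t)) = ennreal (1 / t)"
            using that by (simp flip: ennreal_mult)
          then show "ennreal s * (indicator {0<..} (s * t) * ennreal (1 / (s * t)) * indicator {1..2} (s / (s * t))) =
            indicator {1/2..1} t * ennreal (1 / t)"
            using that by (auto simp: indicator_def zero_less_mult_iff field_simps)
        qed
        finally show ?thesis .
      qed
      then show "(\<integral>\<^sup>+t. indicator {0<..} (r x) * \<Psi> (r x) * ennreal (h x) *
        (indicator {0<..} t * ennreal (1 / t) * indicator {1..2} (r x / t)) \<partial>lborel) =
        L * (indicator {0<..} (r x) * \<Psi> (r x) * ennreal (h x))"
        by (subst nn_integral_cmult) (auto simp: indicator_def mult_ac)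
    qed
    also have "\<dots> = L * F"
      unfolding F_def by (rule nn_integral_cmult) measurable
    finally have "L * F = K * M" using D1 by simp
    hence "F = K * M / L"
      using Lfin Lpos by (metis ennreal_mult_divide_eq infinity_ennreal_def mult.commute)
    hence "F = M / L * K"
      by (simp add: ennreal_times_divide mult.commute)
    then show "(\<integral>\<^sup>+x. indicator {0<..} (r x) * \<Psi> (r x) * ennreal (h x) \<partial>lborel) =
      M / L * (\<integral>\<^sup>+t. indicator {0<..} t * ennreal (t powr (DIM('a) + p - 1)) * \<Psi> t \<partial>lborel)"
      by (simp add: F_def K_def q_def)
  qed
qed

section \<open>Consequences of scaling\<close>

text \<open>Dilation by 2 preserves \<open>E\<close> and shows that the integral equals
  \<open>2 powr (DIM('a) + p)\<close> times itself. This factor exceeds 1, so the only finite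
  solution is 0.\<close>

lemma nn_integral_homogeneous_cone:
  fixes h :: "'a::euclidean_space \<Rightarrow> real" and p :: real
  assumes [measurable]: "h \<in> borel_measurable borel" "E \<in> sets borel"
    and h: "\<And>c x. c > 0 \<Longrightarrow> h (c *\<^sub>R x) = c powr p * h x"
    and E: "\<And>c x. c > 0 \<Longrightarrow> c *\<^sub>R x \<in> E \<longleftrightarrow> x \<in> E"
    and p: "DIM('a) + p > 0"
    and fin: "(\<integral>\<^sup>+x. indicator E x * ennreal (h x) \<partial>lborel) \<noteq> \<infinity>"
  shows "(\<integral>\<^sup>+x. indicator E x * ennreal (h x) \<partial>lborel) = 0"
proof -
  define J where "J = (\<integral>\<^sup>+x. indicator E x * ennreal (h x) \<partial>lborel)"
  have "J = ennreal (2 ^ DIM('a)) * (\<integral>\<^sup>+x. indicator E (2 *\<^sub>R x) * ennreal (h (2 *\<^sub>R x)) \<partial>lborel)"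
    unfolding J_def by (rule nn_integral_lborel_scaleR) auto
  also have "(\<integral>\<^sup>+x. indicator E (2 *\<^sub>R x) * ennreal (h (2 *\<^sub>R x)) \<partial>lborel) =
      (\<integral>\<^sup>+x. ennreal (2 powr p) * (indicator E x * ennreal (h x)) \<partial>lborel)"
    by (intro nn_integral_cong) (auto simp: h E indicator_def ennreal_mult')
  also have "\<dots> = ennreal (2 powr p) * J"
    unfolding J_def by (rule nn_integral_cmult) measurable
  finally have J: "J = ennreal (2 powr (DIM('a) + p)) * J"
    by (simp add: powr_add powr_realpow ennreal_mult mult.assoc)
  obtain j where j: "J = ennreal j" "j \<ge> 0"
    using fin by (auto simp: J_def[symmetric] less_top intro: ennreal_cases[of J])
  have "j = 2 powr (DIM('a) + p) * j"
    using J j by (simp flip: ennreal_mult)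
  moreover have "(2::real) powr (DIM('a) + p) > 1"
    using p by simp
  ultimately have "j = 0" by (metis less_irrefl mult_cancel_right1)
  then show ?thesis using j by (simp add: J_def)
qed

text \<open>As \<open>c\<close> tends to 0 from the right,
  \<open>c powr - k * f (c *\<^sub>R x)\<close> is constantly \<open>f x\<close>, yet it tends to
  \<open>0 * f 0\<close>, because \<open>f\<close> is continuous at the origin and
  \<open>- k > 0\<close>.\<close>

lemma positively_homogeneous_neg:
  assumes "positively_homogeneous k f" "k < 0"
  shows "f x = 0"
proof -
  from assms have cont: "continuous_on UNIV f" and hom: "\<And>c x. c > 0 \<Longrightarrow> f (c *\<^sub>R x) = c powr k * f x"
    by (auto simp: positively_homogeneous_def)
  have "((\<lambda>c::real. c *\<^sub>R x) \<longlongrightarrow> 0 *\<^sub>R x) (at_right 0)"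
    by (intro tendsto_intros)
  hence "((\<lambda>c::real. f (c *\<^sub>R x)) \<longlongrightarrow> f 0) (at_right 0)"
    using cont isCont_tendsto_compose[of 0 f "\<lambda>c. c *\<^sub>R x" "at_right 0"]
    by (simp add: continuous_on_eq_continuous_at)
  moreover have "((\<lambda>c::real. c powr - k) \<longlongrightarrow> 0) (at_right 0)"
    using tendsto_powr'[of "\<lambda>c. c" 0 "at_right (0::real)" "\<lambda>_. - k" "- k"] assms(2)
      eventually_at_right_less[of "0::real"]
    by (simp add: eventually_mono[OF _ less_imp_le])
  ultimately have "((\<lambda>c::real. c powr - k * f (c *\<^sub>R x)) \<longlongrightarrow> 0 * f 0) (at_right 0)"
    by (intro tendsto_mult)
  moreover have "\<forall>\<^sub>F c::real in at_right 0. c powr - k * f (c *\<^sub>R x) = f x"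
    using eventually_at_right_less[of 0]
    by eventually_elim (simp add: hom powr_minus field_simps)
  ultimately have "((\<lambda>c::real. f x) \<longlongrightarrow> 0 * f 0) (at_right 0)"
    by (rule Lim_transform_eventually)
  then show ?thesis by (simp add: tendsto_const_iff)
qed

section \<open>The Gamma integral\<close>

text \<open>Substitution \<open>u = t powr d\<close> in Euler's integral for
  \<open>Gamma (q / d)\<close>. It evaluates the radial integral that the polar formula attaches to
  \<open>exp (- g)\<close>.\<close>

lemma nn_integral_powr_exp_powr:
  fixes d q :: real
  assumes "d > 0" "q > 0"
  shows "(\<integral>\<^sup>+t. indicator {0<..} t * ennreal (t powr (q - 1)) * ennreal (exp (- (t powr d))) \<partial>lborel) =
    ennreal (Gamma (q / d) / d)"
proof -
  have pos: "q / d > 0" using assms by simp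
  have img: "(\<lambda>t. t powr d) ` {0<..} = {0<..}"
  proof safe
    fix x :: real assume "x > 0"
    with assms show "x \<in> (\<lambda>t. t powr d) ` {0<..}"
      by (intro image_eqI[of _ _ "x powr (1 / d)"]) (auto simp: powr_powr)
  qed auto
  \<comment> \<open>The endpoint 0 is dropped because \<open>t powr d\<close> need not be
    differentiable there when \<open>d < 1\<close>.\<close>
  have "((\<lambda>t. t powr (q / d - 1) / exp t) has_integral Gamma (q / d)) {0<..}"
    using Gamma_integral_real[OF pos]
    by (rule has_integral_spike_set_eq[THEN iffD1, rotated -1]) (auto intro: negligible_subset[of "{0}"])
  hence "(\<lambda>t. t powr (q / d - 1) / exp t) absolutely_integrable_on (\<lambda>t. t powr d) ` {0<..} \<and>
      integral ((\<lambda>t. t powr d) ` {0<..}) (\<lambda>t. t powr (q / d - 1) / exp t) = Gamma (q / d)"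
    unfolding img
    by (auto intro!: nonnegative_absolutely_integrable_1 simp: has_integral_iff)
  moreover have "((\<lambda>t. t powr d) has_real_derivative d * t powr (d - 1)) (at t within {0<..})"
    if "t \<in> {0<..}" for t
    using that assms by (auto intro!: derivative_eq_intros)
  moreover have "inj_on (\<lambda>t. t powr d) {0<..}"
    using assms by (intro inj_on_inverseI[where g = "\<lambda>s. s powr (1 / d)"]) (simp add: powr_powr)
  ultimately have "(\<lambda>t. \<bar>d * t powr (d - 1)\<bar> * ((t powr d) powr (q / d - 1) / exp (t powr d))) absolutely_integrable_on {0<..} \<and>
      integral {0<..} (\<lambda>t. \<bar>d * t powr (d - 1)\<bar> * ((t powr d) powr (q / d - 1) / exp (t powr d))) = Gamma (q / d)"
    by (subst has_absolute_integral_change_of_variables_1') auto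
  hence "((\<lambda>t. \<bar>d * t powr (d - 1)\<bar> * ((t powr d) powr (q / d - 1) / exp (t powr d))) has_integral Gamma (q / d)) {0<..}"
    by (auto simp: has_integral_iff absolutely_integrable_on_def)
  \<comment> \<open>The factor \<open>1 / d\<close> cancels the constant of the Jacobian; the
    exponents then add up to \<open>(d - 1) + d * (q / d - 1) = q - 1\<close>.\<close>
  hence "((\<lambda>t. 1 / d * (\<bar>d * t powr (d - 1)\<bar> * ((t powr d) powr (q / d - 1) / exp (t powr d)))) has_integral 1 / d * Gamma (q / d)) {0<..}"
    by (rule has_integral_mult_right)
  hence "((\<lambda>t. t powr (q - 1) * exp (- (t powr d))) has_integral Gamma (q / d) / d) {0<..}"
    unfolding times_divide_eq_left mult_1
  proof (rule has_integral_eq[rotated])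
    fix t :: real assume "t \<in> {0<..}"
    have "d - 1 + d * (q / d - 1) = q - 1"
      using assms by (simp add: field_simps)
    then have "t powr (d - 1) * (t powr d) powr (q / d - 1) = t powr (q - 1)"
      by (metis powr_add powr_powr)
    with \<open>t \<in> {0<..}\<close> assms show "\<bar>d * t powr (d - 1)\<bar> * ((t powr d) powr (q / d - 1) / exp (t powr d)) / d =
        t powr (q - 1) * exp (- (t powr d))"
      by (simp add: abs_mult exp_minus divide_inverse mult.assoc[symmetric])
  qed
  from nn_integral_has_integral_lebesgue[OF _ this]
  have "(\<integral>\<^sup>+t. ennreal (indicator {0<..} t * (t powr (q - 1) * exp (- (t powr d)))) \<partial>lborel) =
      ennreal (Gamma (q / d) / d)"
    by simp
  then show ?thesis
    by (simp add: ennreal_mult' ennreal_indicator mult.assoc)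
qed

section \<open>Null sets and measurability\<close>

text \<open>The preimage of the positive part of \<open>N\<close> under \<open>t powr d\<close> is
  its image under the differentiable map \<open>s powr (1 / d)\<close>, hence negligible. This
  allows \<open>\<phi>\<close> to be changed on a null set inside
  \<open>\<phi> (t powr d)\<close>.\<close>

lemma AE_lebesgue_powr:
  fixes d :: real
  assumes "d \<noteq> 0" "N \<in> null_sets lborel"
  shows "AE t in lebesgue. t > 0 \<longrightarrow> t powr d \<notin> N"
proof -
  have "negligible N"
    using assms(2) by (simp add: negligible_iff_null_sets null_sets_completionI)
  hence "negligible (N \<inter> {0<..})" by (simp add: negligible_Int)
  hence "negligible ((\<lambda>s. s powr (1 / d)) ` (N \<inter> {0<..}))"
    by (intro negligible_differentiable_image_negligible)
      (auto simp: differentiable_on_def real_differentiable_def intro!: exI derivative_eq_intros)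
  moreover have "{t. \<not> (t > 0 \<longrightarrow> t powr d \<notin> N)} \<subseteq> (\<lambda>s. s powr (1 / d)) ` (N \<inter> {0<..})"
    using assms(1) by (auto intro!: image_eqI[of _ _ "_ powr d"] simp: powr_powr)
  ultimately show ?thesis
    unfolding negligible_iff_null_sets by (intro AE_I') auto
qed

text \<open>Completeness does the work: the part of a preimage inside the exceptional null set is a
  subset of a null set, hence measurable, whatever \<open>f\<close> does there.\<close>

lemma borel_measurable_completion_cong_AE:
  fixes f f' :: "'a \<Rightarrow> 'b::topological_space"
  assumes f': "f' \<in> borel_measurable (completion M)"
    and eq: "AE x in completion M. f x = f' x"
  shows "f \<in> borel_measurable (completion M)"
proof (rule measurableI)
  fix B :: "'b set" assume B: "B \<in> sets borel"
  from eq obtain N where N: "N \<in> null_sets (completion M)" "{x \<in> space M. f x \<noteq> f' x} \<subseteq> N"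
    by (auto simp: eventually_ae_filter)
  have "f -` B \<inter> space M \<inter> N \<in> sets (completion M)"
    by (rule null_setsD2[OF completion.complete2[OF _ N(1)]]) auto
  moreover have "f' -` B \<inter> space M - N \<in> sets (completion M)"
    using measurable_sets[OF f' B] N(1) by auto
  moreover have "f -` B \<inter> space M = (f -` B \<inter> space M \<inter> N) \<union> (f' -` B \<inter> space M - N)"
    using N(2) by auto
  ultimately show "f -` B \<inter> space (completion M) \<in> sets (completion M)"
    by (metis sets.Un space_completion)
qed auto

text \<open>The bare equivalence fails in two degenerate cases, which the premises of the first
  implication exclude. If the radial integral of \<open>\<phi>\<close> is 0, for instance for
  \<open>\<phi> = 0\<close>, the first integral can be finite while the second diverges. If
  \<open>\<phi> 0 = 0\<close> and \<open>h\<close> has mass on \<open>{g = 0}\<close>, as for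
  \<open>g x = max x 0\<close> and \<open>h = 1\<close> on the line, that mass is invisible to the
  first integral and makes the second infinite. The second conjunct carries the reverse implication
  and the formula.\<close>

theorem lemma2p1:
  fixes d p :: real
    and \<phi> :: "real \<Rightarrow> real"
    and g h :: "real ^ 'n \<Rightarrow> real"
  assumes "d \<noteq> 0"
    and "\<phi> \<in> borel_measurable (lebesgue_on {0..})"
    and "\<And>t. t \<ge> 0 \<Longrightarrow> \<phi> t \<ge> 0"
    and "set_integrable lebesgue {0<..}
           (\<lambda>t. t powr (real CARD('n) + p - 1) * \<phi> (t powr d))"
    and "positively_homogeneous d g" and "\<And>x. g x \<ge> 0"
    and "positively_homogeneous p h" and "\<And>x. h x \<ge> 0"
  shows
    "((LINT t:{0<..}|lebesgue. t powr (real CARD('n) + p - 1) * \<phi> (t powr d)) > 0 \<and>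
      (\<phi> 0 > 0 \<or> (AE x in lebesgue. g x = 0 \<longrightarrow> h x = 0)) \<longrightarrow>
        (integrable lebesgue (\<lambda>x. \<phi> (g x) * h x) \<longleftrightarrow>
         integrable lebesgue (\<lambda>x. h x * exp (- g x)))) \<and>
     (integrable lebesgue (\<lambda>x. h x * exp (- g x)) \<longrightarrow>
        integrable lebesgue (\<lambda>x. \<phi> (g x) * h x) \<and>
        (LINT x|lebesgue. \<phi> (g x) * h x) =
          d * (LINT t:{0<..}|lebesgue. t powr (real CARD('n) + p - 1) * \<phi> (t powr d))
            / Gamma ((real CARD('n) + p) / d)
          * (LINT x|lebesgue. h x * exp (- g x)))"
proof (cases "p < 0")
  \<comment> \<open>Continuity at the origin forces \<open>h = 0\<close>, so both integrals vanish.
    The remaining case has \<open>q > 0\<close>, as required by the cone argument and the Gamma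
    integral.\<close>
  case True
  then have "h x = 0" for x
    using positively_homogeneous_neg[OF assms(7)] by simp
  then show ?thesis by simp
next
  case False
  define q where "q = real CARD('n) + p"
  have q: "q > 0" using False by (simp add: q_def add_pos_nonneg)
  define \<kappa> where "\<kappa> = (LINT t:{0<..}|lebesgue. t powr (q - 1) * \<phi> (t powr d))"
  have g_hom: "g (c *\<^sub>R x) = c powr d * g x" and h_hom: "h (c *\<^sub>R x) = c powr p * h x" if "c > 0" for c x
    using that assms(5,7) by (auto simp: positively_homogeneous_def)
  have [measurable]: "g \<in> borel_measurable borel" "h \<in> borel_measurable borel"
    using assms(5,7) by (auto simp: positively_homogeneous_def intro: borel_measurable_continuous_onI)
  have g0: "g x \<ge> 0" and h0: "h x \<ge> 0" for x using assms by auto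

  \<comment> \<open>Polar formula for \<open>g\<close>\<close>
  obtain C where C: "\<And>\<Psi>. \<Psi> \<in> borel_measurable borel \<Longrightarrow>
      (\<integral>\<^sup>+x. indicator {0<..} (g x powr (1 / d)) * \<Psi> (g x powr (1 / d)) * ennreal (h x) \<partial>lborel) =
      C * (\<integral>\<^sup>+t. indicator {0<..} t * ennreal (t powr (DIM(real ^ 'n) + p - 1)) * \<Psi> t \<partial>lborel)"
    by (rule nn_integral_polar[of "\<lambda>x. g x powr (1 / d)" h p])
       (use assms(1) in \<open>auto simp: g_hom h_hom powr_mult powr_powr g0\<close>)
  \<comment> \<open>\<open>0 powr a = 0\<close> for every \<open>a\<close>, so
    \<open>g x powr (1 / d)\<close> is positive exactly when \<open>g x\<close> is, also for
    negative \<open>d\<close>.\<close>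
  have polar: "(\<integral>\<^sup>+x. indicator {0<..} (g x) * \<psi> (g x) * ennreal (h x) \<partial>lborel) =
      C * (\<integral>\<^sup>+t. indicator {0<..} t * ennreal (t powr (q - 1)) * \<psi> (t powr d) \<partial>lborel)"
    if [measurable]: "\<psi> \<in> borel_measurable borel" for \<psi> :: "real \<Rightarrow> ennreal"
  proof -
    have "(\<integral>\<^sup>+x. indicator {0<..} (g x) * \<psi> (g x) * ennreal (h x) \<partial>lborel) =
        (\<integral>\<^sup>+x. indicator {0<..} (g x powr (1 / d)) * \<psi> ((g x powr (1 / d)) powr d) * ennreal (h x) \<partial>lborel)"
      using assms(1) g0 by (intro nn_integral_cong) (auto simp: indicator_def powr_powr order_less_le)
    also have "\<dots> = C * (\<integral>\<^sup>+t. indicator {0<..} t * ennreal (t powr (q - 1)) * \<psi> (t powr d) \<partial>lborel)"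
      using C[of "\<lambda>s. \<psi> (s powr d)"] by (simp add: q_def)
    finally show ?thesis .
  qed

  \<comment> \<open>A Borel version of \<open>\<phi>\<close> and measurability of the
    integrands\<close>
  have "(\<lambda>t. if t \<in> {0..} then \<phi> t else 0) \<in> borel_measurable lebesgue"
    using assms(2) by (subst borel_measurable_if) auto
  \<comment> \<open>\<open>\<phi>\<close> is only Lebesgue measurable, so \<open>\<phi> \<circ> g\<close> need not be measurable a priori; applying the polar
    formula to the indicator of a null set shows that a Borel version of \<open>\<phi>\<close> may be used.\<close>
  then obtain \<phi>' where [measurable]: "\<phi>' \<in> borel_measurable borel"
    and \<phi>'_AE: "AE t in lborel. (if t \<in> {0..} then \<phi> t else 0) = \<phi>' t"
    using completion_ex_borel_measurable_real by fastforce
  obtain N where N: "N \<in> null_sets lborel" and \<phi>': "\<And>t. t > 0 \<Longrightarrow> t \<notin> N \<Longrightarrow> \<phi> t = \<phi>' t"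
    using \<phi>'_AE by (force simp: eventually_ae_filter)
  have [measurable]: "N \<in> sets borel" using N by auto

  have K: "(\<integral>\<^sup>+t. indicator {0<..} t * ennreal (t powr (q - 1)) * ennreal (\<phi>' (t powr d)) \<partial>lborel) = ennreal \<kappa>"
  proof -
    have "(\<integral>\<^sup>+t. indicator {0<..} t * ennreal (t powr (q - 1)) * ennreal (\<phi>' (t powr d)) \<partial>lborel) =
        (\<integral>\<^sup>+t. indicator {0<..} t * ennreal (t powr (q - 1)) * ennreal (\<phi>' (t powr d)) \<partial>lebesgue)"
      by (simp add: nn_integral_completion)
    also have "\<dots> = (\<integral>\<^sup>+t. ennreal (indicator {0<..} t *\<^sub>R (t powr (q - 1) * \<phi> (t powr d))) \<partial>lebesgue)"
    proof (rule nn_integral_cong_AE)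
      show "AE t in lebesgue. indicator {0<..} t * ennreal (t powr (q - 1)) * ennreal (\<phi>' (t powr d)) =
          ennreal (indicator {0<..} t *\<^sub>R (t powr (q - 1) * \<phi> (t powr d)))"
        using AE_lebesgue_powr[OF assms(1) N]
        by eventually_elim (auto simp: indicator_def \<phi>' ennreal_mult')
    qed
    also have "\<dots> = ennreal \<kappa>"
      unfolding \<kappa>_def set_lebesgue_integral_def
      using assms(3,4)
      by (intro nn_integral_eq_integral) (auto simp: set_integrable_def q_def)
    finally show ?thesis .
  qed
  have \<kappa>0: "\<kappa> \<ge> 0"
    unfolding \<kappa>_def set_lebesgue_integral_def using assms(3) by (intro integral_nonneg_AE) auto

  have "(\<integral>\<^sup>+t. indicator {0<..} t * ennreal (t powr (q - 1)) * indicator N (t powr d) \<partial>lebesgue) =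
      (\<integral>\<^sup>+t. 0 \<partial>(lebesgue :: real measure))"
    using AE_lebesgue_powr[OF assms(1) N]
    by (intro nn_integral_cong_AE) (auto elim!: eventually_mono simp: indicator_def)
  \<comment> \<open>\<open>C\<close> may be infinite, but \<open>\<infinity> * 0 = 0\<close> in
    \<open>ennreal\<close>.\<close>
  hence "(\<integral>\<^sup>+x. indicator {0<..} (g x) * indicator N (g x) * ennreal (h x) \<partial>lborel) = 0"
    by (subst polar) (auto simp: nn_integral_completion)
  hence "AE x in lborel. g x > 0 \<longrightarrow> g x \<in> N \<longrightarrow> h x = 0"
    by (subst (asm) nn_integral_0_iff_AE)
       (use h0 in \<open>auto elim!: eventually_mono simp: indicator_def ennreal_eq_0_iff antisym split: if_splits\<close>)
  \<comment> \<open>The value \<open>\<phi> 0\<close> is kept apart: \<open>{g = 0}\<close> may have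
    positive measure, whereas \<open>\<phi>'\<close> is unconstrained at the single point 0.\<close>
  hence AE_eq: "AE x in lebesgue. \<phi> (g x) * h x = (if g x = 0 then \<phi> 0 else \<phi>' (g x)) * h x"
    using g0 by (auto elim!: eventually_mono simp: \<phi>' order_less_le AE_completion_iff)

  have meas\<phi>: "(\<lambda>x. \<phi> (g x) * h x) \<in> borel_measurable lebesgue"
  proof -
    have "(\<lambda>x. (if g x = 0 then \<phi> 0 else \<phi>' (g x)) * h x) \<in> borel_measurable lebesgue"
      by (intro measurable_completion) measurable
    then show ?thesis
      using AE_eq by (rule borel_measurable_completion_cong_AE)
  qed
  have meas_exp: "(\<lambda>x. h x * exp (- g x)) \<in> borel_measurable lebesgue"
    by (intro measurable_completion) measurable

  \<comment> \<open>Splitting both integrals along \<open>g = 0\<close> and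
    \<open>g > 0\<close>\<close>
  define A where "A = (\<integral>\<^sup>+x. indicator {x. g x = 0} x * ennreal (h x) \<partial>lborel)"
  define E where "E = (\<integral>\<^sup>+t. indicator {0<..} t * ennreal (t powr (q - 1)) * ennreal (exp (- (t powr d))) \<partial>lborel)"
  have nn_\<phi>: "(\<integral>\<^sup>+x. ennreal (\<phi> (g x) * h x) \<partial>lebesgue) = ennreal (\<phi> 0) * A + C * ennreal \<kappa>"
  proof -
    have "(\<integral>\<^sup>+x. ennreal (\<phi> (g x) * h x) \<partial>lebesgue) =
        (\<integral>\<^sup>+x. ennreal ((if g x = 0 then \<phi> 0 else \<phi>' (g x)) * h x) \<partial>lebesgue)"
      using AE_eq by (intro nn_integral_cong_AE) (auto elim!: eventually_mono)
    also have "\<dots> = (\<integral>\<^sup>+x. ennreal (\<phi> 0) * (indicator {x. g x = 0} x * ennreal (h x)) +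
        indicator {0<..} (g x) * ennreal (\<phi>' (g x)) * ennreal (h x) \<partial>lborel)"
      unfolding nn_integral_completion
      using g0 h0 assms(3) by (intro nn_integral_cong) (auto simp: indicator_def ennreal_mult'' order_less_le)
    also have "\<dots> = ennreal (\<phi> 0) * A +
        (\<integral>\<^sup>+x. indicator {0<..} (g x) * ennreal (\<phi>' (g x)) * ennreal (h x) \<partial>lborel)"
      unfolding A_def by (subst nn_integral_add, measurable) (subst nn_integral_cmult, auto)
    also have "\<dots> = ennreal (\<phi> 0) * A + C * ennreal \<kappa>"
      by (subst polar) (auto simp: K)
    finally show ?thesis .
  qed
  have nn_exp: "(\<integral>\<^sup>+x. ennreal (h x * exp (- g x)) \<partial>lebesgue) = A + C * E"
  proof -
    have "(\<integral>\<^sup>+x. ennreal (h x * exp (- g x)) \<partial>lebesgue) =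
        (\<integral>\<^sup>+x. (indicator {x. g x = 0} x * ennreal (h x)) +
        indicator {0<..} (g x) * ennreal (exp (- g x)) * ennreal (h x) \<partial>lborel)"
      unfolding nn_integral_completion
      using g0 h0 by (intro nn_integral_cong) (auto simp: indicator_def ennreal_mult order_less_le mult.commute)
    also have "\<dots> = A +
        (\<integral>\<^sup>+x. indicator {0<..} (g x) * ennreal (exp (- g x)) * ennreal (h x) \<partial>lborel)"
      unfolding A_def by (subst nn_integral_add) auto
    also have "\<dots> = A + C * E"
      by (subst polar[of "\<lambda>s. ennreal (exp (- s))"]) (auto simp: E_def)
    finally show ?thesis .
  qed

  \<comment> \<open>Comparison of the two parts\<close>
  have A: "A = 0" if "A < \<infinity>"
    unfolding A_def
    by (rule nn_integral_homogeneous_cone[of h _ p])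
       (use that q in \<open>auto simp: A_def q_def h_hom g_hom\<close>)
  \<comment> \<open>For \<open>d > 0\<close> the common factor \<open>C\<close> leaves the ratio
    \<open>\<kappa> / E = d * \<kappa> / Gamma (q / d)\<close>. If \<open>C\<close> is infinite,
    \<open>C * \<kappa>\<close> is finite only for \<open>\<kappa> = 0\<close>, hence the premise
    \<open>\<kappa> > 0\<close>, whereas \<open>C * E\<close> is infinite because
    \<open>E > 0\<close>.\<close>
  have CE: "(\<kappa> > 0 \<longrightarrow> C * ennreal \<kappa> < \<infinity> \<longrightarrow> C * E < \<infinity>) \<and>
    (C * E < \<infinity> \<longrightarrow> C * ennreal \<kappa> < \<infinity> \<and>
      enn2real (C * ennreal \<kappa>) = d * \<kappa> / Gamma (q / d) * enn2real (C * E))"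
  proof (cases "d > 0")
    case True
    have \<Gamma>: "Gamma (q / d) > 0" using True q by (simp add: Gamma_real_pos)
    have E: "E = ennreal (Gamma (q / d) / d)"
      unfolding E_def using True q by (rule nn_integral_powr_exp_powr)
    show ?thesis
    proof (cases C)
      case (real c)
      then show ?thesis
        using True \<Gamma> \<kappa>0 by (simp add: E flip: ennreal_mult)
    next
      case top
      then show ?thesis
        using True \<Gamma> by (simp add: E ennreal_top_mult)
    qed
  next
    \<comment> \<open>For \<open>d < 0\<close> continuity gives \<open>g = 0\<close>, so the left
      side of \<open>polar\<close> is 0 and both products vanish. The identity then reads 0 = 0,
      whatever value \<open>Gamma\<close> takes at the negative argument.\<close>
    case False
    then have "g x = 0" for x
      using positively_homogeneous_neg[OF assms(5)] assms(1) by simp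
    then have "C * ennreal \<kappa> = 0" "C * E = 0"
      using polar[of "\<lambda>s. ennreal (\<phi>' s)"] polar[of "\<lambda>s. ennreal (exp (- s))"]
      by (simp_all add: K E_def)
    then show ?thesis by (simp only:) simp
  qed

  \<comment> \<open>Integrability and the value of the integral\<close>
  have int_\<phi>: "integrable lebesgue (\<lambda>x. \<phi> (g x) * h x) \<longleftrightarrow> ennreal (\<phi> 0) * A + C * ennreal \<kappa> < \<infinity>"
    using meas\<phi> assms(3) g0 h0 by (simp add: integrable_iff_bounded abs_mult flip: nn_\<phi>)
  have int_exp: "integrable lebesgue (\<lambda>x. h x * exp (- g x)) \<longleftrightarrow> A + C * E < \<infinity>"
    using meas_exp h0 by (simp add: integrable_iff_bounded abs_mult flip: nn_exp)
  have part2: "integrable lebesgue (\<lambda>x. \<phi> (g x) * h x) \<and>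
      (LINT x|lebesgue. \<phi> (g x) * h x) = d * \<kappa> / Gamma (q / d) * (LINT x|lebesgue. h x * exp (- g x))"
    if "integrable lebesgue (\<lambda>x. h x * exp (- g x))"
  proof -
    \<comment> \<open>A finite \<open>A\<close> is already 0, so \<open>{g = 0}\<close> contributes
      to neither integral.\<close>
    have fin: "A = 0" "C * E < \<infinity>"
      using that A by (auto simp: int_exp)
    have "(LINT x|lebesgue. \<phi> (g x) * h x) = enn2real (C * ennreal \<kappa>)"
      using meas\<phi> assms(3) g0 h0 by (subst integral_eq_nn_integral) (auto simp: nn_\<phi> fin)
    moreover have "(LINT x|lebesgue. h x * exp (- g x)) = enn2real (C * E)"
      using meas_exp h0 by (subst integral_eq_nn_integral) (auto simp: nn_exp fin)
    ultimately show ?thesis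
      using CE fin(2) by (simp add: int_\<phi> fin)
  qed
  have part1: "integrable lebesgue (\<lambda>x. h x * exp (- g x))"
    if "\<kappa> > 0" and nondeg: "\<phi> 0 > 0 \<or> (AE x in lebesgue. g x = 0 \<longrightarrow> h x = 0)"
      and int: "integrable lebesgue (\<lambda>x. \<phi> (g x) * h x)"
  proof -
    have fin: "ennreal (\<phi> 0) * A < \<infinity>" "C * ennreal \<kappa> < \<infinity>"
      using int by (auto simp: int_\<phi>)
    \<comment> \<open>If \<open>\<phi> 0 > 0\<close>, finiteness of \<open>\<phi> 0 * A\<close>
      makes \<open>A\<close> finite, and the cone alternative leaves only 0; the other disjunct says
      directly that \<open>h\<close> has no mass on \<open>{g = 0}\<close>.\<close>
    from nondeg have "A = 0"
    proof
      assume "\<phi> 0 > 0"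
      then show "A = 0" using fin(1) A by (auto simp: ennreal_mult_less_top)
    next
      assume "AE x in lebesgue. g x = 0 \<longrightarrow> h x = 0"
      then show "A = 0"
        unfolding A_def AE_completion_iff
        by (subst nn_integral_0_iff_AE) (auto elim!: eventually_mono simp: indicator_def)
    qed
    then show ?thesis
      using CE fin(2) that(1) by (simp add: int_exp)
  qed
  show ?thesis
    using part1 part2 by (auto simp: \<kappa>_def q_def)
qed

end
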